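(* Let $m_1$ and $m_2$ be even integers. Let $[c_1,y]\in L_{m_1}$ and $[c_2,y]\in L_{m_2}$, where $y$ is an arbitrary element of $K\langle X\rangle$. Then $$[c_1,y][c_2,y]\in I_{m_1+m_2-1}.$$
   Context: $K$ is a field of characteristic $0$, $X=\{x_1,\dots,x_n\}$, $K\langle X\rangle$ is the free associative algebra on $X$ over $K$, $c_1,c_2$ are elements of $K\langle X\rangle$, and $[u,v]=uv-vu$. The lower central series is defined by $L_1=K\langle X\rangle$ and $L_m=[L_{m-1},K\langle X\rangle]$ for $m\ge 2$, i.e. $L_m$ is the $K$-span of all $[u,v]$ with $u\in L_{m-1}$, $v\in K\langle X\rangle$. For $m\ge 2$, $I_m=K\langle X\rangle\cdot L_m$ is the two-sided ideal of $K\langle X\rangle$ generated by $L_m$. *)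

theory Defs
  imports Complex_Main "HOL-Library.Poly_Mapping"
begin

text \<open>
  Words over an alphabet form a monoid under concatenation, written additively because the
  convolution product of \<^theory>\<open>HOL-Library.Poly_Mapping\<close> adds its exponents.
\<close>

instantiation list :: (type) monoid_add
begin

definition zero_list :: "'a list" where "zero_list = []"

definition plus_list :: "'a list \<Rightarrow> 'a list \<Rightarrow> 'a list" where "plus_list = append"

instance
  by standard (simp_all add: zero_list_def plus_list_def)

end

text \<open>
  The free associative unital algebra on the alphabet \<open>'x\<close> over \<open>'k\<close> is the monoid algebra of the
  words: finitely supported functions from words to \<open>'k\<close> with the convolution product.
  A generator \<open>x\<close> is \<open>Poly_Mapping.single [x] 1\<close>, and the scalar \<open>k\<close> is \<open>Poly_Mapping.single 0 k\<close>.
\<close>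

type_synonym ('x, 'k) free_alg = "'x list \<Rightarrow>\<^sub>0 'k"

definition fa_scale :: "'k::field \<Rightarrow> ('x, 'k) free_alg \<Rightarrow> ('x, 'k) free_alg" where
  "fa_scale k p = Poly_Mapping.single 0 k * p"

global_interpretation free_alg: vector_space fa_scale
  by standard
    (simp_all add: fa_scale_def distrib_left distrib_right single_add mult_single
      flip: mult.assoc)

abbreviation fa_span :: "('x, 'k::field) free_alg set \<Rightarrow> ('x, 'k) free_alg set" where
  "fa_span \<equiv> free_alg.span"

definition commutator :: "'a::ring \<Rightarrow> 'a \<Rightarrow> 'a" where
  "commutator u v = u * v - v * u"

text \<open>The series starts at index 1; the value at index 0 is an arbitrary convention.\<close>

fun lower_central :: "nat \<Rightarrow> ('x, 'k::field) free_alg set" where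
  "lower_central 0 = UNIV"
| "lower_central (Suc 0) = UNIV"
| "lower_central (Suc (Suc m)) =
     fa_span {commutator u v | u v. u \<in> lower_central (Suc m)}"

definition lower_central_ideal :: "nat \<Rightarrow> ('x, 'k::field) free_alg set" where
  "lower_central_ideal m = fa_span {a * u | a u. u \<in> lower_central m}"

text \<open>
  The left multiples of the elements of \<open>lower_central m\<close> already span a two-sided ideal,
  which is therefore the two-sided ideal generated by \<open>lower_central m\<close>.
\<close>

definition two_sided_ideal :: "'a::ring_1 set \<Rightarrow> bool" where
  "two_sided_ideal J \<longleftrightarrow> 0 \<in> J \<and> (\<forall>p\<in>J. \<forall>q\<in>J. p + q \<in> J) \<and>
     (\<forall>p\<in>J. \<forall>a. a * p \<in> J \<and> p * a \<in> J)"

lemma single_0_central: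
  fixes p :: "('x, 'k::field) free_alg"
  shows "p * Poly_Mapping.single 0 k = Poly_Mapping.single 0 k * p"
proof (induction p rule: update_induct)
  case const
  show ?case by simp
next
  case (update f v c)
  have "Poly_Mapping.update v c f = f + Poly_Mapping.single v c"
    using update(1)
    by (intro poly_mapping_eqI)
      (auto simp: lookup_update lookup_add lookup_single when_def in_keys_iff)
  then show ?case
    using update(3) by (simp add: distrib_left distrib_right mult_single mult.commute[of c k])
qed

lemma fa_scale_mult_left: "a * fa_scale k p = fa_scale k (a * p)"
  by (simp add: fa_scale_def single_0_central flip: mult.assoc)

lemma fa_scale_mult_right: "fa_scale k p * a = fa_scale k (p * a)"
  by (simp add: fa_scale_def mult.assoc)

lemma lower_central_Suc_subset:
  "lower_central (Suc (Suc m)) \<subseteq> (lower_central (Suc m) :: ('x, 'k::field) free_alg set)"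
proof (induction m)
  case 0
  show ?case by simp
next
  case (Suc m)
  have "{commutator u v | u v. u \<in> lower_central (Suc (Suc m))}
      \<subseteq> {commutator u v | u v :: ('x, 'k) free_alg. u \<in> lower_central (Suc m)}"
    using Suc by blast
  then show ?case
    unfolding lower_central.simps(3) by (rule free_alg.span_mono)
qed

lemma two_sided_ideal_lower_central_ideal:
  assumes "1 \<le> m"
  shows "two_sided_ideal (lower_central_ideal m :: ('x, 'k::field) free_alg set)"
proof -
  let ?S = "{a * u | a u. u \<in> lower_central m} :: ('x, 'k) free_alg set"
  obtain l where l: "m = Suc l" using assms by (cases m) auto
  have left: "b * p \<in> fa_span ?S" if "p \<in> fa_span ?S" for p b
    using that
  proof (induction rule: free_alg.span_induct_alt)
    case base
    show ?case by (simp add: free_alg.span_zero)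
  next
    case (step c x y)
    then obtain a u where "x = a * u" "u \<in> lower_central m" by blast
    then have "b * x \<in> ?S" by (auto simp flip: mult.assoc)
    then show ?case using step
      by (simp add: distrib_left fa_scale_mult_left free_alg.span_add free_alg.span_scale
          free_alg.span_base)
  qed
  have right: "p * b \<in> fa_span ?S" if "p \<in> fa_span ?S" for p b
    using that
  proof (induction rule: free_alg.span_induct_alt)
    case base
    show ?case by (simp add: free_alg.span_zero)
  next
    case (step c x y)
    then obtain a u where x: "x = a * u" and u: "u \<in> lower_central m" by blast
    have "commutator u b \<in> lower_central (Suc m)"
      using u unfolding l by (auto intro: free_alg.span_base)
    then have "commutator u b \<in> lower_central m"
      using lower_central_Suc_subset unfolding l by blast
    then have "a * commutator u b \<in> fa_span ?S" "(a * b) * u \<in> fa_span ?S"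
      using u by (auto intro!: free_alg.span_base)
    moreover have "x * b = a * commutator u b + (a * b) * u"
      by (simp add: x commutator_def algebra_simps)
    ultimately have "x * b \<in> fa_span ?S" by (simp only: free_alg.span_add)
    then show ?case using step
      by (simp add: distrib_right fa_scale_mult_right free_alg.span_add free_alg.span_scale)
  qed
  show ?thesis
    unfolding two_sided_ideal_def lower_central_ideal_def
    using left right free_alg.span_zero free_alg.span_add by blast
qed

lemma lower_central_ideal_eq_hull:
  assumes "1 \<le> m"
  shows "lower_central_ideal m = two_sided_ideal hull (lower_central m :: ('x, 'k::field) free_alg set)"
proof (rule hull_unique[symmetric])
  show "lower_central m \<subseteq> (lower_central_ideal m :: ('x, 'k) free_alg set)"
    unfolding lower_central_ideal_def
    by (rule subsetI, rule free_alg.span_base, rule CollectI) (rule exI[of _ 1], auto)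
  show "two_sided_ideal (lower_central_ideal m :: ('x, 'k) free_alg set)"
    using assms by (rule two_sided_ideal_lower_central_ideal)
next
  fix J :: "('x, 'k) free_alg set"
  assume J: "lower_central m \<subseteq> J" "two_sided_ideal J"
  have "free_alg.subspace J"
    using J(2) unfolding free_alg.subspace_def two_sided_ideal_def fa_scale_def by blast
  moreover have "{a * u | a u. u \<in> lower_central m} \<subseteq> J"
    using J unfolding two_sided_ideal_def by blast
  ultimately show "lower_central_ideal m \<subseteq> J"
    unfolding lower_central_ideal_def by (rule free_alg.span_minimal[rotated])
qed

end

(* Put D_i = [c_i, -], a derivation of K<X> into L_{m_i}. By the Jacobi identity D_1 maps L_k into
   L_{m_1+k-1}, so D_1 D_2 maps K<X> into L_{m_1+m_2-1}. Expanding D_1 D_2 (y^2) by the Leibniz rule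
   gives D_1 y * D_2 y + D_2 y * D_1 y in I_{m_1+m_2-1}; as [D_1 y, D_2 y] lies in L_{m_1+m_2}, also
   2 * D_1 y * D_2 y lies in I_{m_1+m_2-1}. *)

theory Submission
  imports Defs
begin

lemma commutator_fa_scale_right: "commutator u (fa_scale k v) = fa_scale k (commutator u v)"
  by (simp add: commutator_def fa_scale_mult_left fa_scale_mult_right
      free_alg.scale_right_diff_distrib)

lemma commutator_add_right: "commutator u (v + w) = commutator u v + commutator u w"
  by (simp add: commutator_def algebra_simps)

lemma commutator_zero_right: "commutator u 0 = 0"
  by (simp add: commutator_def)

text \<open>The right-hand side has left-nested brackets because each step of the lower central
  series appends an arbitrary right entry.\<close>

lemma commutator_Jacobi:
  "commutator u (commutator v w) = commutator (commutator u v) w - commutator (commutator u w) v"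
  by (simp add: commutator_def algebra_simps)

lemma subspace_lower_central: "free_alg.subspace (lower_central m)"
  by (cases m rule: lower_central.cases) simp_all

lemma subspace_lower_central_ideal: "free_alg.subspace (lower_central_ideal m)"
  by (simp add: lower_central_ideal_def)

lemma commutator_in_lower_central_Suc:
  "u \<in> lower_central (Suc m) \<Longrightarrow> commutator u v \<in> lower_central (Suc (Suc m))"
  by (auto intro: free_alg.span_base)

text \<open>Linearity of the bracket in its second entry reduces membership to a spanning set. Both
  inductions below use this to pass to single brackets \<open>commutator a b\<close>.\<close>

lemma commutator_span_mem:
  assumes "free_alg.subspace V" and "\<And>v. v \<in> S \<Longrightarrow> commutator u v \<in> V" and "v \<in> fa_span S"
  shows "commutator u v \<in> V"
  using assms(3)
proof (induction rule: free_alg.span_induct_alt)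
  case base
  show ?case
    using assms(1) by (simp add: commutator_zero_right free_alg.subspace_0)
next
  case (step k x z)
  then show ?case
    using assms(1,2)
    by (simp add: commutator_add_right commutator_fa_scale_right free_alg.subspace_add
        free_alg.subspace_scale)
qed

text \<open>Induction on \<open>j\<close>: the Jacobi identity splits [u,[a,b]] into [[u,a],b] and
  [[u,b],a], where a lies one level higher up the series than [a,b].\<close>

lemma commutator_lower_central:
  assumes "u \<in> lower_central (Suc i)" and "v \<in> lower_central (Suc j)"
  shows "commutator u v \<in> lower_central (Suc (Suc (i + j)))"
  using assms
proof (induction j arbitrary: i u v)
  case 0
  then show ?case by (simp add: commutator_in_lower_central_Suc del: lower_central.simps)
next
  case (Suc j)
  show ?case
  proof (rule commutator_span_mem[OF subspace_lower_central])
    show "v \<in> fa_span {commutator a b | a b. a \<in> lower_central (Suc j)}"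
      using Suc.prems(2) by simp
  next
    fix x :: "('a, 'b) free_alg"
    assume "x \<in> {commutator a b | a b. a \<in> lower_central (Suc j)}"
    then obtain a b where x: "x = commutator a b" and a: "a \<in> lower_central (Suc j)"
      by blast
    have "commutator (commutator u a) b \<in> lower_central (Suc (Suc (i + Suc j)))"
      using commutator_in_lower_central_Suc[OF Suc.IH[OF Suc.prems(1) a]]
      by (simp del: lower_central.simps)
    \<comment> \<open>The induction hypothesis is applied to [u,b] at index \<open>Suc i\<close>,
      which is why \<open>i\<close> is generalized in the induction.\<close>
    moreover have "commutator (commutator u b) a \<in> lower_central (Suc (Suc (i + Suc j)))"
      using Suc.IH[OF commutator_in_lower_central_Suc[OF Suc.prems(1)] a]
      by (simp del: lower_central.simps)
    ultimately show "commutator u x \<in> lower_central (Suc (Suc (i + Suc j)))"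
      unfolding x commutator_Jacobi by (rule free_alg.subspace_diff[OF subspace_lower_central])
  qed
qed

text \<open>The hypothesis concerns the values of the derivation [c,-], not the place of c in the
  series, so it serves as the base case. In the Jacobi step, [[c,b],a] is a bracket of two elements
  of known depth.\<close>

lemma commutator_lower_central_shift:
  assumes c: "\<And>y. commutator c y \<in> lower_central (Suc i)" and "v \<in> lower_central (Suc j)"
  shows "commutator c v \<in> lower_central (Suc (i + j))"
  using assms(2)
proof (induction j arbitrary: v)
  case 0
  show ?case using c by simp
next
  case (Suc j)
  show ?case
  proof (rule commutator_span_mem[OF subspace_lower_central])
    show "v \<in> fa_span {commutator a b | a b. a \<in> lower_central (Suc j)}"
      using Suc.prems by simp
  next
    fix x :: "('a, 'b) free_alg"
    assume "x \<in> {commutator a b | a b. a \<in> lower_central (Suc j)}"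
    then obtain a b where x: "x = commutator a b" and a: "a \<in> lower_central (Suc j)"
      by blast
    have "commutator (commutator c a) b \<in> lower_central (Suc (i + Suc j))"
      using commutator_in_lower_central_Suc[OF Suc.IH[OF a]] by (simp del: lower_central.simps)
    moreover have "commutator (commutator c b) a \<in> lower_central (Suc (i + Suc j))"
      using commutator_lower_central[OF c a] by (simp del: lower_central.simps)
    ultimately show "commutator c x \<in> lower_central (Suc (i + Suc j))"
      unfolding x commutator_Jacobi by (rule free_alg.subspace_diff[OF subspace_lower_central])
  qed
qed

lemma lower_central_subset_ideal: "lower_central m \<subseteq> lower_central_ideal m"
  unfolding lower_central_ideal_def
  by (rule subsetI, rule free_alg.span_base, rule CollectI) (rule exI[of _ 1], auto)

text \<open>Characteristic 0 makes 2 invertible, and a subspace is closed under scaling by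
  1/2.\<close>

lemma double_mem_subspace:
  fixes p :: "('x, 'k::field_char_0) free_alg"
  assumes "free_alg.subspace V" and "p + p \<in> V"
  shows "p \<in> V"
proof -
  have "p = fa_scale (1 / 2) (p + p)"
    by (simp add: free_alg.scale_right_distrib flip: free_alg.scale_left_distrib)
  then show ?thesis
    using assms by (metis free_alg.subspace_scale)
qed

theorem lemma3p1:
  fixes c1 c2 :: "('x::finite, 'k::field_char_0) free_alg"
    and m1 m2 :: nat
  assumes "even m1" and "m1 > 0" and "even m2" and "m2 > 0"
    and "\<forall>y. commutator c1 y \<in> lower_central m1"
    and "\<forall>y. commutator c2 y \<in> lower_central m2"
  shows "\<forall>y. commutator c1 y * commutator c2 y \<in> lower_central_ideal (m1 + m2 - 1)"
proof
  fix y
  obtain i j where m1: "m1 = Suc i" and m2: "m2 = Suc j"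
    using assms(2,4) by (metis gr0_implies_Suc)
  have m: "m1 + m2 - 1 = Suc (i + j)"
    by (simp add: m1 m2)
  have c1: "commutator c1 z \<in> lower_central (Suc i)"
    and c2: "commutator c2 z \<in> lower_central (Suc j)" for z
    using assms(5,6) unfolding m1 m2 by auto
  let ?J = "lower_central_ideal (Suc (i + j)) :: ('x, 'k) free_alg set"
  let ?D = "\<lambda>z. commutator c1 (commutator c2 z)"
  have ideal: "two_sided_ideal ?J"
    by (simp add: two_sided_ideal_lower_central_ideal)
  note diff = free_alg.subspace_diff[OF subspace_lower_central_ideal]
  note add = free_alg.subspace_add[OF subspace_lower_central_ideal]
  have D: "?D z \<in> ?J" for z
    using commutator_lower_central_shift[OF c1 c2] lower_central_subset_ideal by blast
  have "?D y * y \<in> ?J" and "y * ?D y \<in> ?J"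
    using ideal D unfolding two_sided_ideal_def by blast+
  \<comment> \<open>This bracket lies in \<open>lower_central (Suc (Suc (i + j)))\<close>, one level
    deeper than required.\<close>
  moreover have "commutator (commutator c1 y) (commutator c2 y) \<in> ?J"
    using commutator_lower_central[OF c1 c2] lower_central_Suc_subset lower_central_subset_ideal
    by blast
  \<comment> \<open>By Leibniz, the first three terms leave the two mixed products of [c1,y] and
    [c2,y]. The added commutator turns the one in the wrong order into a second copy of the desired
    product.\<close>
  ultimately have "?D (y * y) - ?D y * y - y * ?D y
      + commutator (commutator c1 y) (commutator c2 y) \<in> ?J"
    by (intro add diff D)
  also have "?D (y * y) - ?D y * y - y * ?D y + commutator (commutator c1 y) (commutator c2 y)
      = commutator c1 y * commutator c2 y + commutator c1 y * commutator c2 y"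
    by (simp add: commutator_def algebra_simps)
  finally show "commutator c1 y * commutator c2 y \<in> lower_central_ideal (m1 + m2 - 1)"
    unfolding m by (rule double_mem_subspace[OF subspace_lower_central_ideal])
qed

end
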